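(* Suppose the set $\mathsf N$ of non-colluding bidders and the set $\mathsf C$ of colluding bidders are correctly specified. Then the C-PoP mechanism implemented with the dynamic programming (DP) oracle is (ex-post) dominant strategy incentive compatible for all bidders, including the colluding bidders: (i) for every $i\in\mathsf N$, every valuation $v_i$, and every bids of all other bidders, bidding $b_i=v_i$ maximizes bidder $i$'s utility $u_i$; (ii) for every valuations $(v_i)_{i\in\mathsf C}$ and every bids of the non-colluders, joint truthful bidding $b_i=v_i$ for all $i\in\mathsf C$ maximizes the coalition utility $u_{\mathsf C}$.
   Context: Setting: $r$ identical items, single-minded bidders $\mathsf M=\mathsf N\cup\mathsf C$ (disjoint union), $n=|\mathsf N|$, $c=|\mathsf C|$. Bidder $i$ has valuation $v_i\ge0$ and bid $b_i\ge0$; a mechanism outputs $x_i\in\{0,1\}$ and payments $p_i$. A non-colluder $i$ maximizes $u_i=v_ix_i-p_i$. The colluders act as one entity maximizing $u_{\mathsf C}=\sum_{i\in\mathsf C}(v_ix_i-p_i)$, with exchange of information, items and money among them allowed, so that items won by the coalition are assigned to its highest-valuation members. Notation: $b^{\mathsf N}_k$ is the $k$-th largest bid in $\mathsf N$ ($0$ if $k>n$). $\overline{\mathsf B^{\mathsf N}_k}=\{b^{\mathsf N}_{k+1},\dots,b^{\mathsf N}_n\}$ denotes the bids of rank $k+1,\dots,n$ in $\mathsf N$; $\overline{\mathcal B^{\mathsf N}_k}$ denotes the corresponding random object, under a prior distribution for the bids used by the auctioneer. DP oracle: takes $b^{\mathsf N},n,c$, and a given real objective function $M(p,\overline{\mathsf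 B^{\mathsf N}_k})$ (which depends on the bids only through $\overline{\mathsf B^{\mathsf N}_k}$). For $k=0,\dots,r$ let $p_k\in\arg\max_{p\ge b^{\mathsf N}_{k+1}}M(p,\overline{\mathsf B^{\mathsf N}_k})$ (maximizers assumed to exist, ties broken by a fixed rule, so $p_k$ is a function of $\overline{\mathsf B^{\mathsf N}_k}$). Value functions: $V(p_0,\overline{\mathcal B^{\mathsf N}_0})=M(p_0,\overline{\mathcal B^{\mathsf N}_0})$ and, for $k=1,\dots,r$, $V(p_k,\overline{\mathcal B^{\mathsf N}_k})=\max\{M(p_k,\overline{\mathcal B^{\mathsf N}_k}),\ \mathbb E[V(p_{k-1},\overline{\mathcal B^{\mathsf N}_{k-1}})\mid\overline{\mathcal B^{\mathsf N}_k}]\}$. Then, starting from $k^*=r$, while $k^*\ge1$ and $M(p_{k^*},\overline{\mathsf B^{\mathsf N}_{k^*}})<\mathbb E[V(p_{k^*-1},\overline{\mathcal B^{\mathsf N}_{k^*-1}})\mid\overline{\mathsf B^{\mathsf N}_{k^*}}]$, decrease $k^*$ by $1$. Output $k^*$ and $p^*=p_{k^*}$. C-PoP mechanism: compute $(k^*,p^* )$ from the oracle. Phase 1: the non-colluders with $b_i>p^*$ qualify; if more than $r$ qualify, $r$ of them chosen at random win, otherwise all win; call the winners $\mathsf W_{\mathsf N}$. Phase 2: the colluders with $b_i>p^*$ qualify; if more than $\max\{r-|\mathsf W_{\mathsf N}|,0\}$ qualify, a random subset of that size wins, otherwise all win. Each winner gets one item and pays $p^*$; losers get nothing and pay $0$.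 *)

theory Defs
  imports "HOL-Probability.Probability"
begin

section \<open>Order statistics of the bids\<close>

text \<open>Ranks are 1-based, ties are counted with multiplicity, and ranks beyond
  \<open>card A\<close> give 0.\<close>

definition kth_largest :: "'a set \<Rightarrow> ('a \<Rightarrow> real) \<Rightarrow> nat \<Rightarrow> real" where
  "kth_largest A f k =
    (if 1 \<le> k \<and> k \<le> card A
     then rev (sorted_list_of_multiset (image_mset f (mset_set A))) ! (k - 1) else 0)"

text \<open>The bids of rank \<open>k+1, \<dots>, n\<close>, indexed by their rank, as a point of the product
  space over \<open>{k<..n}\<close>. For \<open>k \<ge> n\<close> this is the unique point of the empty product.\<close>

definition low_bids :: "'a set \<Rightarrow> nat \<Rightarrow> ('a \<Rightarrow> real) \<Rightarrow> nat \<Rightarrow> real" where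
  "low_bids N k b = restrict (kth_largest N b) {k<..card N}"

definition low_space :: "'a set \<Rightarrow> nat \<Rightarrow> (nat \<Rightarrow> real) measure" where
  "low_space N k = Pi\<^sub>M {k<..card N} (\<lambda>_. borel)"


section \<open>Dynamic programming oracle\<close>

text \<open>\<open>g\<close> is a version of the conditional expectation of \<open>f\<close> given the random low bids, i.e.
  \<open>g B = E[f | low_bids N k = B]\<close> under the prior \<open>D\<close> on the bid profiles of \<open>N\<close>. The oracle
  evaluates it at the bids actually reported, so a function of \<open>B\<close> is needed, and not only
  a random variable up to null sets.\<close>

definition cond_exp_version ::
  "('a \<Rightarrow> real) measure \<Rightarrow> 'a set \<Rightarrow> nat \<Rightarrow> (('a \<Rightarrow> real) \<Rightarrow> real) \<Rightarrow> ((nat \<Rightarrow> real) \<Rightarrow> real) \<Rightarrow> bool"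
where
  "cond_exp_version D N k f g \<longleftrightarrow>
     integrable D f \<and>
     g \<in> borel_measurable (low_space N k) \<and>
     (AE \<omega> in D. g (low_bids N k \<omega>) =
        real_cond_exp D (vimage_algebra (space D) (low_bids N k) (low_space N k)) f \<omega>)"

text \<open>In the following, \<open>M q B\<close> is the objective, \<open>p k B\<close> the selected maximizer at level \<open>k\<close>, and
  \<open>e k B\<close> stands for the expectation of the value at level \<open>k - 1\<close> given that the low bids at
  level \<open>k\<close> are \<open>B\<close>; the latter is tied to \<open>dp_value\<close> by requiring that \<open>e k\<close> be a
  \<open>cond_exp_version\<close>.\<close>

primrec dp_value ::
  "(real \<Rightarrow> (nat \<Rightarrow> real) \<Rightarrow> real) \<Rightarrow> (nat \<Rightarrow> (nat \<Rightarrow> real) \<Rightarrow> real) \<Rightarrow>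
   (nat \<Rightarrow> (nat \<Rightarrow> real) \<Rightarrow> real) \<Rightarrow> nat \<Rightarrow> (nat \<Rightarrow> real) \<Rightarrow> real"
where
  "dp_value M p e 0 B = M (p 0 B) B"
| "dp_value M p e (Suc k) B = max (M (p (Suc k) B) B) (e (Suc k) B)"

text \<open>The level at which the downward search from level \<open>k\<close> stops.\<close>

primrec dp_stop ::
  "'a set \<Rightarrow> (real \<Rightarrow> (nat \<Rightarrow> real) \<Rightarrow> real) \<Rightarrow> (nat \<Rightarrow> (nat \<Rightarrow> real) \<Rightarrow> real) \<Rightarrow>
   (nat \<Rightarrow> (nat \<Rightarrow> real) \<Rightarrow> real) \<Rightarrow> ('a \<Rightarrow> real) \<Rightarrow> nat \<Rightarrow> nat"
where
  "dp_stop N M p e b 0 = 0"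
| "dp_stop N M p e b (Suc k) =
    (let B = low_bids N (Suc k) b in
     if M (p (Suc k) B) B < e (Suc k) B then dp_stop N M p e b k else Suc k)"

definition dp_price ::
  "nat \<Rightarrow> 'a set \<Rightarrow> (real \<Rightarrow> (nat \<Rightarrow> real) \<Rightarrow> real) \<Rightarrow> (nat \<Rightarrow> (nat \<Rightarrow> real) \<Rightarrow> real) \<Rightarrow>
   (nat \<Rightarrow> (nat \<Rightarrow> real) \<Rightarrow> real) \<Rightarrow> ('a \<Rightarrow> real) \<Rightarrow> real"
where
  "dp_price r N M p e b = (let k = dp_stop N M p e b r in p k (low_bids N k b))"


section \<open>The C-PoP mechanism\<close>

text \<open>An outcome consists of the allocation \<open>x\<close> and the payments.\<close>

type_synonym 'a outcome = "('a \<Rightarrow> nat) \<times> ('a \<Rightarrow> real)"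

definition lottery :: "'a set \<Rightarrow> nat \<Rightarrow> 'a set pmf" where
  "lottery Q m =
    (if card Q > m then pmf_of_set {W. W \<subseteq> Q \<and> card W = m} else return_pmf Q)"

definition outcome_of :: "real \<Rightarrow> 'a set \<Rightarrow> 'a outcome" where
  "outcome_of q W = ((\<lambda>i. if i \<in> W then 1 else 0), (\<lambda>i. if i \<in> W then q else 0))"

text \<open>The truncated subtraction \<open>r - card W\<^sub>N\<close> is \<open>max {r - |W\<^sub>N|, 0}\<close>.\<close>

definition cpop ::
  "nat \<Rightarrow> 'a set \<Rightarrow> 'a set \<Rightarrow> (real \<Rightarrow> (nat \<Rightarrow> real) \<Rightarrow> real) \<Rightarrow> (nat \<Rightarrow> (nat \<Rightarrow> real) \<Rightarrow> real) \<Rightarrow>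
   (nat \<Rightarrow> (nat \<Rightarrow> real) \<Rightarrow> real) \<Rightarrow> ('a \<Rightarrow> real) \<Rightarrow> 'a outcome pmf"
where
  "cpop r N C M p e b =
    (let q = dp_price r N M p e b in
     bind_pmf (lottery {i \<in> N. b i > q} r) (\<lambda>W\<^sub>N.
     bind_pmf (lottery {i \<in> C. b i > q} (r - card W\<^sub>N)) (\<lambda>W\<^sub>C.
     return_pmf (outcome_of q (W\<^sub>N \<union> W\<^sub>C)))))"


section \<open>Utilities and incentives\<close>

definition utility :: "('a \<Rightarrow> real) \<Rightarrow> 'a \<Rightarrow> 'a outcome \<Rightarrow> real" where
  "utility v i = (\<lambda>(x, pay). v i * real (x i) - pay i)"

text \<open>The colluders pool the items they won and hand them to the members with the highest
  valuations, so \<open>m\<close> items are worth the sum of the \<open>m\<close> largest valuations in \<open>C\<close>.\<close>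

definition coalition_utility :: "('a \<Rightarrow> real) \<Rightarrow> 'a set \<Rightarrow> 'a outcome \<Rightarrow> real" where
  "coalition_utility v C =
    (\<lambda>(x, pay). (\<Sum>j = 1..(\<Sum>i\<in>C. x i). kth_largest C v j) - (\<Sum>i\<in>C. pay i))"

text \<open>The random outcome \<open>P\<close> is at least as good as \<open>Q\<close> under the utility \<open>u\<close>, both ex post
  (whatever the realizations of the lotteries) and in expectation.\<close>

definition ex_post_at_least :: "('b \<Rightarrow> real) \<Rightarrow> 'b pmf \<Rightarrow> 'b pmf \<Rightarrow> bool" where
  "ex_post_at_least u P Q \<longleftrightarrow>
     (\<forall>y\<in>set_pmf P. \<forall>z\<in>set_pmf Q. u z \<le> u y) \<and>
     measure_pmf.expectation Q u \<le> measure_pmf.expectation P u"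

definition nonneg_on :: "'a set \<Rightarrow> ('a \<Rightarrow> real) \<Rightarrow> bool" where
  "nonneg_on A f \<longleftrightarrow> (\<forall>i\<in>A. 0 \<le> f i)"

end

theory Submission
  imports Defs
begin

text \<open>The price selected at level \<open>k\<close> is at least the bid of rank \<open>k + 1\<close>, so at most \<open>k \<le> r\<close>
  non-colluders exceed it: phase 1 never randomizes. If a non-colluder exceeds the
  price both with a deviating bid and with her valuation, then she has rank at most \<open>k\<close>
  either way, so every level from \<open>r\<close> down to \<open>k\<close> sees the same low bids and the search stops
  at the same level with the same price. Hence a deviation wins below her
  valuation only at the price at which truthful bidding wins too. The colluders do not
  influence the price or the number of items left for them, and \<open>m\<close> items at price \<open>q\<close> are
  worth the sum of the \<open>m\<close> largest values \<open>v\<^sub>j - q\<close>, a sum that is largest when \<open>m\<close> is the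
  number of valuations above \<open>q\<close>, or as close to it from below as the supply permits. The
  random choice in phase 2 does not affect this sum, so the comparison is ex post.\<close>

text \<open>The entries above \<open>t\<close> form a prefix of a decreasing list, so the 0-based
  position \<open>k\<close> lies outside it exactly when the prefix has length at most
  \<open>k\<close>.\<close>

lemma sorted_desc_nth_le_iff:
  fixes t :: "'b::linorder"
  assumes "sorted_wrt (\<ge>) xs" "k < length xs"
  shows "xs ! k \<le> t \<longleftrightarrow> length (filter (\<lambda>x. x > t) xs) \<le> k"
  using assms
proof (induction xs arbitrary: k)
  case Nil
  then show ?case by simp
next
  case (Cons x xs)
  show ?case
  proof (cases "x \<le> t")
    case True
    with Cons.prems(1) have *: "\<forall>y\<in>set (x # xs). y \<le> t" by auto
    then have "filter (\<lambda>y. y > t) (x # xs) = []" unfolding filter_empty_conv by auto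
    moreover have "(x # xs) ! k \<le> t" using * Cons.prems(2) nth_mem by blast
    ultimately show ?thesis by (simp only: list.size) simp
  next
    case False
    then show ?thesis using Cons by (cases k) auto
  qed
qed

text \<open>Turns comparisons of order statistics into counts of entries above a threshold, the form
  in which ranks are handled below.\<close>

lemma kth_largest_le_iff:
  assumes "finite A" "1 \<le> k" "k \<le> card A"
  shows "kth_largest A f k \<le> t \<longleftrightarrow> card {i \<in> A. f i > t} < k"
proof -
  define xs where "xs = rev (sorted_list_of_multiset (image_mset f (mset_set A)))"
  have mset_xs: "mset xs = image_mset f (mset_set A)" by (simp add: xs_def)
  have "length xs = card A" by (metis mset_xs size_image_mset size_mset size_mset_set)
  moreover have "sorted_wrt (\<ge>) xs" by (simp add: xs_def sorted_wrt_rev)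
  moreover have "length (filter (\<lambda>x. x > t) xs) = card {i \<in> A. f i > t}"
  proof -
    have "mset (filter (\<lambda>x. x > t) xs) = image_mset f (mset_set {i \<in> A. f i > t})"
      using assms(1) by (simp add: mset_xs filter_mset_image_mset)
    then show ?thesis by (metis size_image_mset size_mset size_mset_set)
  qed
  ultimately have "xs ! (k - 1) \<le> t \<longleftrightarrow> card {i \<in> A. f i > t} \<le> k - 1"
    using sorted_desc_nth_le_iff[of xs "k - 1" t] assms by simp
  then show ?thesis using assms by (auto simp: kth_largest_def xs_def)
qed

lemma card_above_kth_largest_le:
  assumes "finite A" "kth_largest A f (k + 1) \<le> q"
  shows "card {i \<in> A. f i > q} \<le> k"
proof (cases "k + 1 \<le> card A")
  case True
  then show ?thesis using assms kth_largest_le_iff[of A "k + 1" f q] by simp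
next
  case False
  \<comment> \<open>Rank \<open>k + 1\<close> does not exist here and \<open>kth_largest\<close> is
    the default 0; the bound comes from the size of \<open>A\<close>.\<close>
  have "card {i \<in> A. f i > q} \<le> card A" by (rule card_mono) (auto simp: assms)
  with False show ?thesis by simp
qed

text \<open>For \<open>t \<le> q\<close> the changed bids count on both sides; for
  \<open>t > q\<close> both counts are at most \<open>k\<close>, hence below every rank
  \<open>j > k\<close>. So the bids of rank \<open>j\<close> have the same upper bounds and
  coincide.\<close>

lemma low_bids_eqI:
  assumes fin: "finite N"
    and same: "\<And>i. i \<in> N \<Longrightarrow> f i \<noteq> g i \<Longrightarrow> f i > q \<and> g i > q"
    and few: "card {i \<in> N. f i > q} \<le> k"
  shows "low_bids N k f = low_bids N k g"
proof -
  have eq: "{i \<in> N. f i > t} = {i \<in> N. g i > t}" if "t \<le> q" for t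
    using same that by force
  have "kth_largest N f j = kth_largest N g j" if j: "j \<in> {k<..card N}" for j
  proof -
    have "card {i \<in> N. f i > t} < j \<longleftrightarrow> card {i \<in> N. g i > t} < j" for t
    proof (cases "t \<le> q")
      case True
      then show ?thesis by (simp add: eq)
    next
      case False
      have "card {i \<in> N. f i > t} \<le> card {i \<in> N. f i > q}"
        and "card {i \<in> N. g i > t} \<le> card {i \<in> N. g i > q}"
        using False fin by (auto intro!: card_mono)
      then show ?thesis using few eq[of q] j by auto
    qed
    then have "kth_largest N f j \<le> t \<longleftrightarrow> kth_largest N g j \<le> t" for t
      using kth_largest_le_iff[OF fin] j by simp
    then show ?thesis by (meson order_antisym order_refl)
  qed
  then show ?thesis unfolding low_bids_def by (rule restrict_ext)
qed

lemma low_bids_cong: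
  assumes "finite N" "\<And>i. i \<in> N \<Longrightarrow> f i = g i"
  shows "low_bids N k f = low_bids N k g"
proof -
  have "image_mset f (mset_set N) = image_mset g (mset_set N)"
    using assms by (intro image_mset_cong) simp
  then have "kth_largest N f = kth_largest N g" by (simp add: kth_largest_def fun_eq_iff)
  then show ?thesis by (simp add: low_bids_def)
qed

lemma dp_stop_le: "dp_stop N M p e b m \<le> m"
  by (induction m) (auto simp: Let_def)

text \<open>The search reads no level below the one where it stops, and a changed bid may show
  there; so agreement is asked only from the stopping level of \<open>b\<close> upwards.\<close>

lemma dp_stop_eqI:
  assumes "\<And>k. dp_stop N M p e b m \<le> k \<Longrightarrow> k \<le> m \<Longrightarrow> low_bids N k b = low_bids N k b'"
  shows "dp_stop N M p e b' m = dp_stop N M p e b m"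
  using assms
proof (induction m)
  case 0
  then show ?case by simp
next
  case (Suc m)
  have "low_bids N (Suc m) b = low_bids N (Suc m) b'" using Suc.prems dp_stop_le by blast
  with Suc show ?case by (simp add: Let_def)
qed

lemma dp_price_eqI:
  assumes "\<And>k. dp_stop N M p e b r \<le> k \<Longrightarrow> k \<le> r \<Longrightarrow> low_bids N k b = low_bids N k b'"
  shows "dp_price r N M p e b' = dp_price r N M p e b"
  using dp_stop_eqI[of N M p e b r b'] assms dp_stop_le[of N M p e b r]
  by (simp add: dp_price_def)

lemma dp_price_cong:
  assumes "finite N" "\<And>i. i \<in> N \<Longrightarrow> b i = b' i"
  shows "dp_price r N M p e b = dp_price r N M p e b'"
  by (rule dp_price_eqI) (use assms low_bids_cong in metis)

lemma set_lottery:
  assumes "finite Q" "W \<in> set_pmf (lottery Q m)"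
  shows "W \<subseteq> Q \<and> card W = min (card Q) m"
proof (cases "card Q > m")
  case True
  \<comment> \<open>The support of \<open>pmf_of_set\<close> is the given set once that set is
    finite and nonempty.\<close>
  have "finite {W. W \<subseteq> Q \<and> card W = m}"
    by (rule finite_subset[of _ "Pow Q"]) (use assms in auto)
  moreover obtain W' where "W' \<subseteq> Q" "card W' = m"
    using True obtain_subset_with_card_n[of m Q] by auto
  then have "{W. W \<subseteq> Q \<and> card W = m} \<noteq> {}" by blast
  ultimately show ?thesis using assms True by (simp add: lottery_def)
next
  case False
  then show ?thesis using assms by (simp add: lottery_def)
qed

text \<open>With at most \<open>r\<close> non-colluders above the price, the first lottery is
  degenerate. The second leaves \<open>W\<close> random but fixes its size, which is all the
  coalition utility sees.\<close>

lemma set_cpop: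
  assumes fin: "finite N" "finite C"
    and few: "card {i \<in> N. b i > dp_price r N M p e b} \<le> r"
    and y: "y \<in> set_pmf (cpop r N C M p e b)"
  defines "q \<equiv> dp_price r N M p e b"
  obtains W where "W \<subseteq> {i \<in> C. b i > q}"
    "card W = min (card {i \<in> C. b i > q}) (r - card {i \<in> N. b i > q})"
    "y = outcome_of q ({i \<in> N. b i > q} \<union> W)"
proof -
  have "lottery {i \<in> N. b i > q} r = return_pmf {i \<in> N. b i > q}"
    using few by (simp add: lottery_def q_def)
  with y obtain W where "W \<in> set_pmf (lottery {i \<in> C. b i > q} (r - card {i \<in> N. b i > q}))"
    "y = outcome_of q ({i \<in> N. b i > q} \<union> W)"
    by (auto simp: cpop_def Let_def bind_return_pmf simp flip: q_def)
  with that set_lottery[of "{i \<in> C. b i > q}"] fin show thesis by auto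
qed

lemma utility_outcome_of: "utility v i (outcome_of q W) = (if i \<in> W then v i - q else 0)"
  by (simp add: utility_def outcome_of_def)

text \<open>Winners outside \<open>C\<close> drop out, and each winner in \<open>W\<close> pays
  \<open>q\<close>, so the payment spreads over the \<open>card W\<close> terms.\<close>

lemma coalition_utility_outcome_of:
  assumes "finite C" "A \<inter> C = {}" "W \<subseteq> C"
  shows "coalition_utility v C (outcome_of q (A \<union> W))
    = (\<Sum>j = 1..card W. kth_largest C v j - q)"
proof -
  have "C \<inter> {i. i \<in> A \<or> i \<in> W} = W" using assms by auto
  then show ?thesis
    using assms(1)
    by (simp add: coalition_utility_def outcome_of_def sum.If_cases sum_subtractf)
qed

text \<open>The terms are positive exactly up to the rank that counts the valuations above
  \<open>q\<close>, so the partial sums grow up to that rank and never grow afterwards.\<close>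

lemma sum_kth_largest_maximal:
  assumes "finite C" "m \<le> card C" "m \<le> K"
  shows "(\<Sum>j = 1..m. kth_largest C v j - q)
    \<le> (\<Sum>j = 1..min (card {i \<in> C. v i > q}) K. kth_largest C v j - q)"
proof -
  define s where "s = card {i \<in> C. v i > q}"
  have "s \<le> card C" unfolding s_def using assms by (auto intro: card_mono)
  have le: "kth_largest C v j - q \<le> 0 \<longleftrightarrow> s < j" if "j \<in> {1..card C}" for j
    using kth_largest_le_iff[OF assms(1), of j v q] that by (simp add: s_def)
  show ?thesis unfolding s_def[symmetric]
  proof (cases "m \<le> min s K")
    case True
    show "(\<Sum>j = 1..m. kth_largest C v j - q) \<le> (\<Sum>j = 1..min s K. kth_largest C v j - q)"
    proof (rule sum_mono2)
      fix j assume "j \<in> {1..min s K} - {1..m}"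
      then show "0 \<le> kth_largest C v j - q" using le[of j] \<open>s \<le> card C\<close> by fastforce
    qed (use True in auto)
  next
    case False
    then have "min s K = s" using assms by simp
    \<comment> \<open>Now \<open>s < m\<close>, and the terms beyond \<open>s\<close> are not
      positive; the signs are flipped so that \<open>sum_mono2\<close> applies.\<close>
    have "(\<Sum>j = 1..m. q - kth_largest C v j) \<ge> (\<Sum>j = 1..s. q - kth_largest C v j)"
    proof (rule sum_mono2)
      fix j assume "j \<in> {1..m} - {1..s}"
      then show "0 \<le> q - kth_largest C v j" using le[of j] assms by fastforce
    qed (use False assms in auto)
    then show "(\<Sum>j = 1..m. kth_largest C v j - q) \<le> (\<Sum>j = 1..min s K. kth_largest C v j - q)"
      unfolding \<open>min s K = s\<close> by (simp add: sum_subtractf)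
  qed
qed

text \<open>A utility that is constant on the support has that constant as its expectation, so both
  parts of the comparison reduce to \<open>d \<le> c\<close>.\<close>

lemma ex_post_at_leastI:
  assumes P: "\<And>y. y \<in> set_pmf P \<Longrightarrow> u y = c" and Q: "\<And>z. z \<in> set_pmf Q \<Longrightarrow> u z = d"
    and "d \<le> c"
  shows "ex_post_at_least u P Q"
proof -
  have "measure_pmf.expectation R u = a" if "\<And>y. y \<in> set_pmf R \<Longrightarrow> u y = a" for R a
  proof -
    have "measure_pmf.expectation R u = measure_pmf.expectation R (\<lambda>_. a)"
      by (rule integral_cong_AE) (use that in \<open>auto simp: AE_measure_pmf_iff\<close>)
    then show ?thesis by simp
  qed
  then show ?thesis using assms by (simp add: ex_post_at_least_def)
qed

theorem theorem4p3:
  fixes r :: nat and N C :: "'a set"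
    and D :: "('a \<Rightarrow> real) measure"
    and M :: "real \<Rightarrow> (nat \<Rightarrow> real) \<Rightarrow> real"
    and p e :: "nat \<Rightarrow> (nat \<Rightarrow> real) \<Rightarrow> real"
  assumes bidders: "finite N" "finite C" "N \<inter> C = {}"
    and prior: "prob_space D" "sets D = sets (Pi\<^sub>M N (\<lambda>_. borel))" "AE \<omega> in D. nonneg_on N \<omega>"
    and maximizer: "\<And>k b. k \<le> r \<Longrightarrow> nonneg_on N b \<Longrightarrow>
          is_arg_max (\<lambda>q. M q (low_bids N k b)) (\<lambda>q. q \<ge> kth_largest N b (k + 1))
            (p k (low_bids N k b))"
    and cond_exp: "\<And>k. 1 \<le> k \<Longrightarrow> k \<le> r \<Longrightarrow>
          cond_exp_version D N k (\<lambda>\<omega>. dp_value M p e (k - 1) (low_bids N (k - 1) \<omega>)) (e k)"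
  shows "(\<forall>i\<in>N. \<forall>v b b'. 0 \<le> v i \<longrightarrow> nonneg_on (N \<union> C) b \<longrightarrow> 0 \<le> b' \<longrightarrow>
            ex_post_at_least (utility v i)
              (cpop r N C M p e (b(i := v i)))
              (cpop r N C M p e (b(i := b')))) \<and>
         (\<forall>v b b'. nonneg_on C v \<longrightarrow> nonneg_on N b \<longrightarrow> nonneg_on C b' \<longrightarrow>
            ex_post_at_least (coalition_utility v C)
              (cpop r N C M p e (override_on b v C))
              (cpop r N C M p e (override_on b b' C)))"
proof -
  let ?q = "dp_price r N M p e"
  \<comment> \<open>The bound is the stopping level, sharper than \<open>r\<close>: it makes the low
    bids agree at every level from there up to \<open>r\<close>.\<close>
  have few: "card {i \<in> N. b i > ?q b} \<le> dp_stop N M p e b r" if "nonneg_on N b" for b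
  proof (rule card_above_kth_largest_le[OF bidders(1)])
    show "kth_largest N b (dp_stop N M p e b r + 1) \<le> ?q b"
      using maximizer[OF dp_stop_le that, of N M p e b] by (simp add: dp_price_def Let_def is_arg_max_def)
  qed
  have few_r: "card {i \<in> N. b i > ?q b} \<le> r" if "nonneg_on N b" for b
    using few[OF that] dp_stop_le order_trans by blast
  have non_colluder: "ex_post_at_least (utility v i)
      (cpop r N C M p e (b(i := v i))) (cpop r N C M p e (b(i := b')))"
    if i: "i \<in> N" and nonneg: "0 \<le> v i" "nonneg_on (N \<union> C) b" "0 \<le> b'" for i v b b'
  proof (rule ex_post_at_leastI)
    have nonneg_upd: "nonneg_on N (b(i := a))" if "0 \<le> a" for a
      using nonneg that by (auto simp: nonneg_on_def)
    \<comment> \<open>The winners \<open>W\<close> of phase 2 lie in \<open>C\<close>, so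
      \<open>i\<close> wins exactly when the bid \<open>a\<close> exceeds the price.\<close>
    have util: "utility v i y = (if a > ?q (b(i := a)) then v i - ?q (b(i := a)) else 0)"
      if a: "0 \<le> a" and y: "y \<in> set_pmf (cpop r N C M p e (b(i := a)))" for a y
    proof -
      obtain W where "W \<subseteq> {j \<in> C. (b(i := a)) j > ?q (b(i := a))}"
        "y = outcome_of (?q (b(i := a))) ({j \<in> N. (b(i := a)) j > ?q (b(i := a))} \<union> W)"
        using set_cpop[OF bidders(1,2) few_r[OF nonneg_upd[OF a]] y] by blast
      then show ?thesis using i bidders(3) by (auto simp: utility_outcome_of)
    qed
    show "utility v i y = (if v i > ?q (b(i := v i)) then v i - ?q (b(i := v i)) else 0)"
      if "y \<in> set_pmf (cpop r N C M p e (b(i := v i)))" for y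
      using util nonneg that by blast
    show "utility v i z = (if b' > ?q (b(i := b')) then v i - ?q (b(i := b')) else 0)"
      if "z \<in> set_pmf (cpop r N C M p e (b(i := b')))" for z
      using util nonneg that by blast
    have "?q (b(i := v i)) = ?q (b(i := b'))"
      if "b' > ?q (b(i := b'))" "v i > ?q (b(i := b'))"
    proof (rule dp_price_eqI)
      fix k assume "dp_stop N M p e (b(i := b')) r \<le> k"
      with few[OF nonneg_upd[OF nonneg(3)]]
      have "card {j \<in> N. (b(i := b')) j > ?q (b(i := b'))} \<le> k" by (rule order_trans)
      then show "low_bids N k (b(i := b')) = low_bids N k (b(i := v i))"
        by (intro low_bids_eqI[OF bidders(1)]) (use that in \<open>auto split: if_splits\<close>)
    qed
    \<comment> \<open>A deviation that loses, or wins at a price of at least \<open>v i\<close>,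
      yields at most 0, while truthful bidding never yields less than 0. In the remaining case the
      prices coincide.\<close>
    then show "(if b' > ?q (b(i := b')) then v i - ?q (b(i := b')) else 0)
      \<le> (if v i > ?q (b(i := v i)) then v i - ?q (b(i := v i)) else 0)"
      by (smt (verit))
  qed
  have coalition: "ex_post_at_least (coalition_utility v C)
      (cpop r N C M p e (override_on b v C)) (cpop r N C M p e (override_on b b' C))"
    if nonneg: "nonneg_on N b" for v b b'
  proof (rule ex_post_at_leastI)
    define q where "q = ?q b"
    define K where "K = r - card {i \<in> N. b i > q}"
    have on_N: "override_on b a C i = b i" if "i \<in> N" for a i
      using that bidders(3) by (auto simp: override_on_def)
    have price: "?q (override_on b a C) = q" for a
      unfolding q_def by (rule dp_price_cong[OF bidders(1) on_N])
    have N_above: "{i \<in> N. override_on b a C i > q} = {i \<in> N. b i > q}" for a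
      using on_N by auto
    have C_above: "{i \<in> C. override_on b a C i > q} = {i \<in> C. a i > q}" for a
      by auto
    \<comment> \<open>The reports \<open>a\<close> matter only through how many of them exceed
      \<open>q\<close>, while items are valued by \<open>v\<close>; one formula covers truth and
      deviation.\<close>
    have util: "coalition_utility v C y
        = (\<Sum>j = 1..min (card {i \<in> C. a i > q}) K. kth_largest C v j - q)"
      if y: "y \<in> set_pmf (cpop r N C M p e (override_on b a C))" for a y
    proof -
      have "card {i \<in> N. override_on b a C i > ?q (override_on b a C)} \<le> r"
        using few_r[OF nonneg] by (simp add: price N_above q_def[symmetric])
      from set_cpop[OF bidders(1,2) this y] obtain W where "W \<subseteq> {i \<in> C. a i > q}"
        "card W = min (card {i \<in> C. a i > q}) K"
        "y = outcome_of q ({i \<in> N. b i > q} \<union> W)"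
        unfolding price N_above C_above K_def by blast
      moreover from this have "W \<subseteq> C" "{i \<in> N. b i > q} \<inter> C = {}" using bidders(3) by auto
      ultimately show ?thesis by (simp add: coalition_utility_outcome_of[OF bidders(2)])
    qed
    show "coalition_utility v C y
        = (\<Sum>j = 1..min (card {i \<in> C. v i > q}) K. kth_largest C v j - q)"
      if "y \<in> set_pmf (cpop r N C M p e (override_on b v C))" for y
      using util that .
    show "coalition_utility v C z
        = (\<Sum>j = 1..min (card {i \<in> C. b' i > q}) K. kth_largest C v j - q)"
      if "z \<in> set_pmf (cpop r N C M p e (override_on b b' C))" for z
      using util that .
    have "card {i \<in> C. b' i > q} \<le> card C" using bidders(2) by (auto intro: card_mono)
    then show "(\<Sum>j = 1..min (card {i \<in> C. b' i > q}) K. kth_largest C v j - q)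
      \<le> (\<Sum>j = 1..min (card {i \<in> C. v i > q}) K. kth_largest C v j - q)"
      by (intro sum_kth_largest_maximal[OF bidders(2)]) auto
  qed
  show ?thesis using non_colluder coalition by blast
qed

end
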